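(* Let $m,n\ge 2$ and let $f(\hat{\mathbf x},\hat{\mathbf y})=\sum_{i,j=1}^m\sum_{k,l=1}^n a_{ijkl}x_ix_jy_ky_l$ be an $m\times n$ biquadratic form with real coefficients, where $\hat{\mathbf x}=(x_1,\dots,x_m)^\top$ and $\hat{\mathbf y}=(y_1,\dots,y_n)^\top$. Then there exists an $(m-1)\times(n-1)\times 1$ tripartite quartic form $h(\mathbf x,\mathbf y,z)$ such that: $f$ is psd if and only if $h$ is psd; $f$ is sos if and only if $h$ is sos; and, when they are sos, $f$ and $h$ have the same sos rank.
   Context: All forms have real coefficients and real variables. A form is psd if it takes only nonnegative values on the whole real space. A quartic form is sos if it is a finite sum of squares of real quadratic forms; for an sos form, its sos rank is the minimum number of squares in such an expression. An $p\times q\times 1$ tripartite quartic form is a homogeneous quartic polynomial $h(\mathbf x,\mathbf y,z)$ in variables $\mathbf x=(x_1,\dots,x_p)$, $\mathbf y=(y_1,\dots,y_q)$ and a single variable $z$ such that in every monomial of $h$ the total degree in the $\mathbf x$-variables is at most $2$ and the total degree in the $\mathbf y$-variables is at most $2$. *)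

theory Defs
  imports Complex_Main "HOL-Library.Poly_Mapping"
begin

text \<open>Real multivariate polynomials are finitely supported maps from monomials (exponent vectors)
  to coefficients; addition, multiplication and powers are those of the ring instance in
  \<^theory>\<open>HOL-Library.Poly_Mapping\<close>, i.e. multiplication is convolution.\<close>

type_synonym 'v rpoly = "('v \<Rightarrow>\<^sub>0 nat) \<Rightarrow>\<^sub>0 real"

definition cst :: "real \<Rightarrow> 'v rpoly" where
  "cst c = Poly_Mapping.single 0 c"

definition var :: "'v \<Rightarrow> 'v rpoly" where
  "var v = Poly_Mapping.single (Poly_Mapping.single v 1) 1"

definition poly_eval :: "('v \<Rightarrow> real) \<Rightarrow> 'v rpoly \<Rightarrow> real" where
  "poly_eval s p =
     (\<Sum>\<mu>\<in>Poly_Mapping.keys p. Poly_Mapping.lookup p \<mu> *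
        (\<Prod>v\<in>Poly_Mapping.keys \<mu>. s v ^ Poly_Mapping.lookup \<mu> v))"

definition degree_in :: "'v set \<Rightarrow> ('v \<Rightarrow>\<^sub>0 nat) \<Rightarrow> nat" where
  "degree_in S \<mu> = (\<Sum>v\<in>Poly_Mapping.keys \<mu> \<inter> S. Poly_Mapping.lookup \<mu> v)"

text \<open>A form of degree \<open>d\<close> in the variables \<open>V\<close>; the zero polynomial is a form of every degree.\<close>

definition form_in :: "'v set \<Rightarrow> nat \<Rightarrow> 'v rpoly \<Rightarrow> bool" where
  "form_in V d p \<longleftrightarrow> (\<forall>\<mu>\<in>Poly_Mapping.keys p. Poly_Mapping.keys \<mu> \<subseteq> V \<and> degree_in V \<mu> = d)"

text \<open>Points assign a value to every element of the type \<open>'v\<close>; the values at variables that do not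
  occur in \<open>p\<close> are irrelevant.\<close>

definition psd :: "'v rpoly \<Rightarrow> bool" where
  "psd p \<longleftrightarrow> (\<forall>s. 0 \<le> poly_eval s p)"

definition sum_of_squares :: "'v set \<Rightarrow> nat \<Rightarrow> 'v rpoly \<Rightarrow> bool" where
  "sum_of_squares V r p \<longleftrightarrow>
     (\<exists>g :: nat \<Rightarrow> 'v rpoly. (\<forall>t<r. form_in V 2 (g t)) \<and> p = (\<Sum>t<r. g t ^ 2))"

definition sos :: "'v set \<Rightarrow> 'v rpoly \<Rightarrow> bool" where
  "sos V p \<longleftrightarrow> (\<exists>r. sum_of_squares V r p)"

text \<open>Meaningful only if \<open>sos V p\<close>; the zero form has rank \<open>0\<close> (empty sum).\<close>

definition sos_rank :: "'v set \<Rightarrow> 'v rpoly \<Rightarrow> nat" where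
  "sos_rank V p = (LEAST r. sum_of_squares V r p)"

datatype vars = X nat | Y nat | Z

definition xvars :: "nat \<Rightarrow> vars set" where
  "xvars p = X ` {1..p}"

definition yvars :: "nat \<Rightarrow> vars set" where
  "yvars q = Y ` {1..q}"

definition biquadratic_vars :: "nat \<Rightarrow> nat \<Rightarrow> vars set" where
  "biquadratic_vars m n = xvars m \<union> yvars n"

definition biquadratic_form ::
    "nat \<Rightarrow> nat \<Rightarrow> (nat \<Rightarrow> nat \<Rightarrow> nat \<Rightarrow> nat \<Rightarrow> real) \<Rightarrow> vars rpoly" where
  "biquadratic_form m n a =
     (\<Sum>i=1..m. \<Sum>j=1..m. \<Sum>k=1..n. \<Sum>l=1..n.
        cst (a i j k l) * var (X i) * var (X j) * var (Y k) * var (Y l))"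

definition tripartite_vars :: "nat \<Rightarrow> nat \<Rightarrow> vars set" where
  "tripartite_vars p q = xvars p \<union> yvars q \<union> {Z}"

text \<open>The \<open>p \<times> q \<times> 1\<close> tripartite quartic forms.\<close>

definition tripartite_quartic_form :: "nat \<Rightarrow> nat \<Rightarrow> vars rpoly \<Rightarrow> bool" where
  "tripartite_quartic_form p q h \<longleftrightarrow>
     form_in (tripartite_vars p q) 4 h \<and>
     (\<forall>\<mu>\<in>Poly_Mapping.keys h. degree_in (xvars p) \<mu> \<le> 2 \<and> degree_in (yvars q) \<mu> \<le> 2)"

end

theory Submission
  imports Defs
begin

text \<open>The form \<open>h\<close> is obtained from \<open>f\<close> by identifying both \<open>x\<^sub>m\<close> and \<open>y\<^sub>n\<close> with \<open>z\<close>. Since \<open>f\<close> is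
  homogeneous of degree 2 in each block, it is recovered from its values at \<open>x\<^sub>m = y\<^sub>n = 1\<close>, first
  where \<open>x\<^sub>m y\<^sub>n \<noteq> 0\<close> and then everywhere by continuity. Identification of variables turns a sum of \<open>r\<close>
  squares for \<open>f\<close> into one for \<open>h\<close>. Conversely, in \<open>h = \<Sum> g\<^sub>t\<^sup>2\<close> each \<open>g\<^sub>t\<close> has degree at most 1 in \<open>x\<close>
  and at most 1 in \<open>y\<close>, because the leading parts of the squares cannot cancel; hence \<open>g\<^sub>t\<close> lifts to
  a bilinear form, and the squares of the lifts sum to \<open>f\<close>. So both forms are sums of \<open>r\<close> squares for
  the same numbers \<open>r\<close>.\<close>

section \<open>Evaluation and degrees of polynomials\<close>

lemma poly_mapping_sum_single:
  "p = (\<Sum>\<mu>\<in>Poly_Mapping.keys p. Poly_Mapping.single \<mu> (Poly_Mapping.lookup p \<mu>))"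
  by (rule poly_mapping_eqI) (simp add: lookup_sum lookup_single when_def in_keys_iff)

lemma in_keys_singleD: "\<nu> \<in> Poly_Mapping.keys (Poly_Mapping.single \<mu> c) \<Longrightarrow> \<nu> = \<mu>"
  by (auto split: if_splits)

lemma in_keys_sumE:
  assumes "\<mu> \<in> Poly_Mapping.keys (\<Sum>i\<in>I. p i)"
  obtains i where "i \<in> I" "\<mu> \<in> Poly_Mapping.keys (p i)"
  using assms keys_sum by fastforce

lemma keys_plus_nat:
  fixes \<mu> \<nu> :: "'v \<Rightarrow>\<^sub>0 nat"
  shows "Poly_Mapping.keys (\<mu> + \<nu>) = Poly_Mapping.keys \<mu> \<union> Poly_Mapping.keys \<nu>"
  by (auto simp: in_keys_iff lookup_add)

definition monom_eval :: "('v \<Rightarrow> real) \<Rightarrow> ('v \<Rightarrow>\<^sub>0 nat) \<Rightarrow> real" where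
  "monom_eval s \<mu> = (\<Prod>v\<in>Poly_Mapping.keys \<mu>. s v ^ Poly_Mapping.lookup \<mu> v)"

text \<open>Variables outside the support contribute exponent 0, hence factor 1. This lets several
  monomials be evaluated over one common index set.\<close>

lemma monom_eval_superset:
  assumes "finite A" "Poly_Mapping.keys \<mu> \<subseteq> A"
  shows "monom_eval s \<mu> = (\<Prod>v\<in>A. s v ^ Poly_Mapping.lookup \<mu> v)"
  unfolding monom_eval_def using assms
  by (intro prod.mono_neutral_left) (auto simp: in_keys_iff)

lemma monom_eval_zero [simp]: "monom_eval s 0 = 1"
  by (simp add: monom_eval_def)

lemma monom_eval_one [simp]: "monom_eval (\<lambda>_. 1) \<mu> = 1"
  by (simp add: monom_eval_def)

lemma monom_eval_plus: "monom_eval s (\<mu> + \<nu>) = monom_eval s \<mu> * monom_eval s \<nu>"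
proof -
  let ?A = "Poly_Mapping.keys \<mu> \<union> Poly_Mapping.keys \<nu>"
  have "monom_eval s (\<mu> + \<nu>) = (\<Prod>v\<in>?A. s v ^ Poly_Mapping.lookup (\<mu> + \<nu>) v)"
    by (rule monom_eval_superset) (auto simp: keys_plus_nat)
  moreover have "monom_eval s \<mu> = (\<Prod>v\<in>?A. s v ^ Poly_Mapping.lookup \<mu> v)"
    by (rule monom_eval_superset) auto
  moreover have "monom_eval s \<nu> = (\<Prod>v\<in>?A. s v ^ Poly_Mapping.lookup \<nu> v)"
    by (rule monom_eval_superset) auto
  ultimately show ?thesis
    by (simp add: lookup_add power_add prod.distrib)
qed

lemma monom_eval_single [simp]: "monom_eval s (Poly_Mapping.single v k) = s v ^ k"
  by (simp add: monom_eval_def)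

lemma monom_eval_sum: "monom_eval s (\<Sum>i\<in>I. \<mu> i) = (\<Prod>i\<in>I. monom_eval s (\<mu> i))"
  by (induction I rule: infinite_finite_induct) (simp_all add: monom_eval_plus)

lemma poly_eval_monom_eval:
  "poly_eval s p = (\<Sum>\<mu>\<in>Poly_Mapping.keys p. Poly_Mapping.lookup p \<mu> * monom_eval s \<mu>)"
  by (simp add: poly_eval_def monom_eval_def)

lemma poly_eval_superset:
  assumes "finite A" "Poly_Mapping.keys p \<subseteq> A"
  shows "poly_eval s p = (\<Sum>\<mu>\<in>A. Poly_Mapping.lookup p \<mu> * monom_eval s \<mu>)"
  unfolding poly_eval_monom_eval using assms
  by (intro sum.mono_neutral_left) (auto simp: in_keys_iff)

lemma poly_eval_zero [simp]: "poly_eval s 0 = 0"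
  by (simp add: poly_eval_def)

lemma poly_eval_single [simp]:
  "poly_eval s (Poly_Mapping.single \<mu> c) = c * monom_eval s \<mu>"
  by (simp add: poly_eval_monom_eval)

lemma poly_eval_plus [simp]: "poly_eval s (p + q) = poly_eval s p + poly_eval s q"
proof -
  let ?A = "Poly_Mapping.keys p \<union> Poly_Mapping.keys q"
  have "poly_eval s (p + q) = (\<Sum>\<mu>\<in>?A. Poly_Mapping.lookup (p + q) \<mu> * monom_eval s \<mu>)"
    by (rule poly_eval_superset) (auto simp: keys_add)
  moreover have "poly_eval s p = (\<Sum>\<mu>\<in>?A. Poly_Mapping.lookup p \<mu> * monom_eval s \<mu>)"
    by (rule poly_eval_superset) auto
  moreover have "poly_eval s q = (\<Sum>\<mu>\<in>?A. Poly_Mapping.lookup q \<mu> * monom_eval s \<mu>)"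
    by (rule poly_eval_superset) auto
  ultimately show ?thesis
    by (simp add: lookup_add distrib_right sum.distrib)
qed

lemma poly_eval_sum [simp]: "poly_eval s (\<Sum>i\<in>I. p i) = (\<Sum>i\<in>I. poly_eval s (p i))"
  by (induction I rule: infinite_finite_induct) simp_all

lemma poly_eval_mult [simp]: "poly_eval s (p * q) = poly_eval s p * poly_eval s q"
proof -
  let ?l = "Poly_Mapping.lookup"
  \<comment> \<open>Convolution is handled by expanding both factors into single monomials, where
    multiplication adds exponents and \<open>monom_eval_plus\<close> applies.\<close>
  have "p * q = (\<Sum>\<mu>\<in>Poly_Mapping.keys p. Poly_Mapping.single \<mu> (?l p \<mu>)) *
      (\<Sum>\<nu>\<in>Poly_Mapping.keys q. Poly_Mapping.single \<nu> (?l q \<nu>))"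
    by (simp flip: poly_mapping_sum_single)
  also have "poly_eval s \<dots> = poly_eval s p * poly_eval s q"
    by (simp add: sum_product mult_single monom_eval_plus poly_eval_monom_eval[of s p]
        poly_eval_monom_eval[of s q] mult_ac)
  finally show ?thesis .
qed

lemma poly_eval_square [simp]: "poly_eval s (p ^ 2) = poly_eval s p ^ 2"
  by (simp add: power2_eq_square)

lemma poly_eval_cst [simp]: "poly_eval s (cst c) = c"
  by (simp add: cst_def)

lemma poly_eval_var [simp]: "poly_eval s (var v) = s v"
  by (simp add: var_def)

section \<open>Degree in a set of variables, scaling, and independence of monomials\<close>

lemma degree_in_superset:
  assumes "finite A" "Poly_Mapping.keys \<mu> \<subseteq> A"
  shows "degree_in S \<mu> = (\<Sum>v\<in>A \<inter> S. Poly_Mapping.lookup \<mu> v)"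
  unfolding degree_in_def using assms
  by (intro sum.mono_neutral_left) (auto simp: in_keys_iff)

lemma degree_in_zero [simp]: "degree_in S 0 = 0"
  by (simp add: degree_in_def)

lemma degree_in_plus [simp]: "degree_in S (\<mu> + \<nu>) = degree_in S \<mu> + degree_in S \<nu>"
proof -
  let ?A = "Poly_Mapping.keys \<mu> \<union> Poly_Mapping.keys \<nu>"
  have "degree_in S (\<mu> + \<nu>) = (\<Sum>v\<in>?A \<inter> S. Poly_Mapping.lookup (\<mu> + \<nu>) v)"
    by (rule degree_in_superset) (auto simp: keys_plus_nat)
  moreover have "degree_in S \<mu> = (\<Sum>v\<in>?A \<inter> S. Poly_Mapping.lookup \<mu> v)"
    by (rule degree_in_superset) auto
  moreover have "degree_in S \<nu> = (\<Sum>v\<in>?A \<inter> S. Poly_Mapping.lookup \<nu> v)"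
    by (rule degree_in_superset) auto
  ultimately show ?thesis
    by (simp add: lookup_add sum.distrib)
qed

lemma degree_in_single [simp]:
  "degree_in S (Poly_Mapping.single v k) = (if v \<in> S then k else 0)"
  by (simp add: degree_in_def)

lemma degree_in_sum: "degree_in S (\<Sum>i\<in>I. \<mu> i) = (\<Sum>i\<in>I. degree_in S (\<mu> i))"
  by (induction I rule: infinite_finite_induct) simp_all

lemma degree_in_mono: "S \<subseteq> T \<Longrightarrow> degree_in S \<mu> \<le> degree_in T \<mu>"
  unfolding degree_in_def by (rule sum_mono2) auto

lemma degree_in_keys_subset:
  "Poly_Mapping.keys \<mu> \<subseteq> S \<Longrightarrow> degree_in S \<mu> = (\<Sum>v\<in>Poly_Mapping.keys \<mu>. Poly_Mapping.lookup \<mu> v)"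
  by (simp add: degree_in_def Int_absorb2)

text \<open>Each factor from \<open>S\<close> contributes \<open>c\<close> to the power of its
  exponent, so scaling makes the degree in \<open>S\<close> visible to evaluation. It serves with
  \<open>c = 2\<close> on one variable for independence, and with \<open>c\<close> tending to
  infinity for leading parts.\<close>

lemma monom_eval_scale:
  "monom_eval (\<lambda>v. if v \<in> S then c * s v else s v) \<mu> = c ^ degree_in S \<mu> * monom_eval s \<mu>"
proof -
  have "monom_eval (\<lambda>v. if v \<in> S then c * s v else s v) \<mu> =
      (\<Prod>v\<in>Poly_Mapping.keys \<mu>. (if v \<in> S then c ^ Poly_Mapping.lookup \<mu> v else 1) *
         s v ^ Poly_Mapping.lookup \<mu> v)"
    unfolding monom_eval_def by (intro prod.cong) (auto simp: power_mult_distrib)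
  then show ?thesis
    by (simp add: prod.distrib monom_eval_def degree_in_def power_sum prod.inter_restrict)
qed

text \<open>Monomials are distinct characters of the multiplicative monoid of points, so this is
  Dedekind's independence argument, with doubling of one coordinate as the separating element.\<close>

lemma monom_eval_independent:
  assumes "finite A" "\<And>s. (\<Sum>\<mu>\<in>A. c \<mu> * monom_eval s \<mu>) = 0" "\<mu> \<in> A"
  shows "c \<mu> = 0"
  using assms
proof (induction A arbitrary: c \<mu> rule: finite_induct)
  case (insert \<nu> A)
  have eq: "c \<nu> * monom_eval s \<nu> + (\<Sum>\<mu>\<in>A. c \<mu> * monom_eval s \<mu>) = 0" for s
    using insert.prems(1)[of s] insert.hyps by simp
  have zero: "c \<kappa> = 0" if "\<kappa> \<in> A" for \<kappa>
  proof -
    have "\<kappa> \<noteq> \<nu>" using that insert.hyps by auto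
    then obtain v where v: "Poly_Mapping.lookup \<kappa> v \<noteq> Poly_Mapping.lookup \<nu> v"
      by (metis poly_mapping_eqI)
    let ?d = "degree_in {v}"
    have d: "?d \<kappa> \<noteq> ?d \<nu>"
      using v by (simp add: degree_in_def in_keys_iff Int_insert_right)
    \<comment> \<open>Doubling the coordinate \<open>v\<close> and subtracting
      \<open>2 ^ ?d \<nu>\<close> times the original relation eliminates \<open>\<nu>\<close>. The
      factor left on \<open>c \<kappa>\<close> is nonzero, since the two exponents of
      \<open>v\<close> differ.\<close>
    have "(\<Sum>\<mu>\<in>A. (c \<mu> * (2 ^ ?d \<mu> - 2 ^ ?d \<nu>)) * monom_eval s \<mu>) = 0" for s
    proof -
      have "c \<nu> * (2 ^ ?d \<nu> * monom_eval s \<nu>) + (\<Sum>\<mu>\<in>A. c \<mu> * (2 ^ ?d \<mu> * monom_eval s \<mu>)) = 0"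
        using eq[of "\<lambda>w. if w \<in> {v} then 2 * s w else s w"]
        by (simp only: monom_eval_scale)
      moreover have "c \<nu> * monom_eval s \<nu> = - (\<Sum>\<mu>\<in>A. c \<mu> * monom_eval s \<mu>)"
        using eq[of s] by linarith
      then have "c \<nu> * (2 ^ ?d \<nu> * monom_eval s \<nu>) = - (\<Sum>\<mu>\<in>A. 2 ^ ?d \<nu> * (c \<mu> * monom_eval s \<mu>))"
        by (simp only: mult.left_commute[of "c \<nu>"]) (simp only: mult_minus_right sum_distrib_left)
      ultimately have "(\<Sum>\<mu>\<in>A. c \<mu> * (2 ^ ?d \<mu> * monom_eval s \<mu>) - 2 ^ ?d \<nu> * (c \<mu> * monom_eval s \<mu>)) = 0"
        by (simp only: sum_subtractf)
      then show ?thesis by (simp only: left_diff_distrib right_diff_distrib mult_ac)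
    qed
    then have "c \<kappa> * (2 ^ ?d \<kappa> - 2 ^ ?d \<nu>) = 0"
      by (rule insert.IH) (rule that)
    then show ?thesis using d by simp
  qed
  have "c \<nu> = 0" using eq[of "\<lambda>_. 1"] zero by simp
  then show ?case using zero insert.prems(2) by auto
qed simp

text \<open>By independence of monomials a polynomial is determined by its values. Identities
  between sums of squares can thus be checked pointwise.\<close>

lemma poly_eval_inject:
  assumes "\<And>s. poly_eval s p = poly_eval s q"
  shows "p = q"
proof (rule poly_mapping_eqI)
  fix \<mu>
  \<comment> \<open>Inserting \<open>\<mu>\<close> covers monomials outside both supports as
    well.\<close>
  let ?A = "insert \<mu> (Poly_Mapping.keys p \<union> Poly_Mapping.keys q)"
  have "(\<Sum>\<mu>\<in>?A. (Poly_Mapping.lookup p \<mu> - Poly_Mapping.lookup q \<mu>) * monom_eval s \<mu>) = 0" for s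
  proof -
    have "poly_eval s p = (\<Sum>\<mu>\<in>?A. Poly_Mapping.lookup p \<mu> * monom_eval s \<mu>)"
      by (rule poly_eval_superset) auto
    moreover have "poly_eval s q = (\<Sum>\<mu>\<in>?A. Poly_Mapping.lookup q \<mu> * monom_eval s \<mu>)"
      by (rule poly_eval_superset) auto
    ultimately show ?thesis
      using assms[of s] by (simp only: left_diff_distrib sum_subtractf)
  qed
  then have "Poly_Mapping.lookup p \<mu> - Poly_Mapping.lookup q \<mu> = 0"
    by (rule monom_eval_independent[rotated]) auto
  then show "Poly_Mapping.lookup p \<mu> = Poly_Mapping.lookup q \<mu>" by simp
qed

section \<open>Forms and sums of squares\<close>

lemma form_in_single:
  "Poly_Mapping.keys \<mu> \<subseteq> V \<Longrightarrow> degree_in V \<mu> = d \<Longrightarrow> form_in V d (Poly_Mapping.single \<mu> c)"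
  by (auto simp: form_in_def split: if_splits)

lemma form_in_sum:
  assumes "\<And>i. i \<in> I \<Longrightarrow> form_in V d (p i)"
  shows "form_in V d (\<Sum>i\<in>I. p i)"
  using keys_sum[of p I] assms unfolding form_in_def by blast

text \<open>The substitution homomorphism induced by \<open>\<sigma>\<close>. Identified variables
  have their exponents added, and monomials that collide have their coefficients added, so
  \<open>\<sigma>\<close> may be non-injective.\<close>

definition rename_vars :: "('v \<Rightarrow> 'w) \<Rightarrow> 'v rpoly \<Rightarrow> 'w rpoly" where
  "rename_vars \<sigma> p = (\<Sum>\<mu>\<in>Poly_Mapping.keys p.
     Poly_Mapping.single
       (\<Sum>v\<in>Poly_Mapping.keys \<mu>. Poly_Mapping.single (\<sigma> v) (Poly_Mapping.lookup \<mu> v))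
       (Poly_Mapping.lookup p \<mu>))"

lemma poly_eval_rename_vars: "poly_eval s (rename_vars \<sigma> p) = poly_eval (s \<circ> \<sigma>) p"
  by (simp add: rename_vars_def monom_eval_sum poly_eval_def[of "s \<circ> \<sigma>"])

lemma form_in_rename_vars:
  assumes "form_in V d p" "\<sigma> ` V \<subseteq> W"
  shows "form_in W d (rename_vars \<sigma> p)"
  unfolding rename_vars_def
proof (intro form_in_sum form_in_single)
  fix \<mu> assume "\<mu> \<in> Poly_Mapping.keys p"
  then have \<mu>: "Poly_Mapping.keys \<mu> \<subseteq> V" "degree_in V \<mu> = d"
    using assms by (auto simp: form_in_def)
  let ?\<nu> = "\<Sum>v\<in>Poly_Mapping.keys \<mu>. Poly_Mapping.single (\<sigma> v) (Poly_Mapping.lookup \<mu> v)"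
  show "Poly_Mapping.keys ?\<nu> \<subseteq> W"
    using keys_sum[of "\<lambda>v. Poly_Mapping.single (\<sigma> v) (Poly_Mapping.lookup \<mu> v)" "Poly_Mapping.keys \<mu>"]
      \<mu> assms(2) by (fastforce split: if_splits)
  have "degree_in W ?\<nu> = (\<Sum>v\<in>Poly_Mapping.keys \<mu>. Poly_Mapping.lookup \<mu> v)"
    using \<mu> assms(2) by (auto simp: degree_in_sum image_subset_iff subset_iff intro!: sum.cong)
  then show "degree_in W ?\<nu> = d"
    using \<mu> by (simp add: degree_in_keys_subset)
qed

text \<open>Substitution commutes with squares and sums and keeps total degree. The target
  \<open>q\<close> is specified only through its values, so it may be given by any formula.\<close>

lemma sum_of_squares_rename_vars:
  assumes "sum_of_squares V r p" "\<sigma> ` V \<subseteq> W"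
    and "\<And>s. poly_eval s q = poly_eval (s \<circ> \<sigma>) p"
  shows "sum_of_squares W r q"
proof -
  obtain g where g: "\<forall>t<r. form_in V 2 (g t)" "p = (\<Sum>t<r. g t ^ 2)"
    using assms(1) by (auto simp: sum_of_squares_def)
  have "q = (\<Sum>t<r. rename_vars \<sigma> (g t) ^ 2)"
    by (rule poly_eval_inject) (simp add: assms(3) g(2) poly_eval_rename_vars)
  then show ?thesis
    unfolding sum_of_squares_def using g(1) form_in_rename_vars[OF _ assms(2)]
    by (intro exI[of _ "\<lambda>t. rename_vars \<sigma> (g t)"]) auto
qed

text \<open>A monomial of degree \<open>k\<close> in \<open>S\<close> picks up
  \<open>c ^ k / c ^ d\<close>, which tends to 1 for \<open>k = d\<close> and to 0 for
  \<open>k < d\<close>. The limit therefore extracts the part of degree exactly \<open>d\<close> in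
  \<open>S\<close>.\<close>

lemma poly_eval_scale_tendsto:
  assumes "\<And>\<mu>. \<mu> \<in> Poly_Mapping.keys p \<Longrightarrow> degree_in S \<mu> \<le> d"
  shows "((\<lambda>c. poly_eval (\<lambda>v. if v \<in> S then c * s v else s v) p / c ^ d) \<longlongrightarrow>
    (\<Sum>\<mu>\<in>{\<mu> \<in> Poly_Mapping.keys p. degree_in S \<mu> = d}. Poly_Mapping.lookup p \<mu> * monom_eval s \<mu>))
    at_top"
proof -
  have lim: "((\<lambda>c::real. c ^ k / c ^ d) \<longlongrightarrow> (if k = d then 1 else 0)) at_top" if "k \<le> d" for k
  proof (cases "k = d")
    case True
    have "eventually (\<lambda>c::real. c ^ k / c ^ d = 1) at_top"
      using eventually_gt_at_top[of 0] by eventually_elim (simp add: True)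
    then show ?thesis using True by (simp add: tendsto_eventually)
  next
    case False
    then have "((\<lambda>c::real. inverse c ^ (d - k)) \<longlongrightarrow> 0 ^ (d - k)) at_top"
      by (intro tendsto_power tendsto_inverse_0_at_top filterlim_ident)
    moreover have "eventually (\<lambda>c::real. inverse c ^ (d - k) = c ^ k / c ^ d) at_top"
      using eventually_gt_at_top[of 0]
      by eventually_elim (use that in \<open>simp add: power_diff power_inverse field_simps\<close>)
    ultimately have "((\<lambda>c::real. c ^ k / c ^ d) \<longlongrightarrow> 0 ^ (d - k)) at_top"
      by (rule Lim_transform_eventually)
    then show ?thesis using False that by (simp add: zero_power)
  qed
  have "((\<lambda>c. \<Sum>\<mu>\<in>Poly_Mapping.keys p. Poly_Mapping.lookup p \<mu> * monom_eval s \<mu> *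
        (c ^ degree_in S \<mu> / c ^ d)) \<longlongrightarrow>
      (\<Sum>\<mu>\<in>Poly_Mapping.keys p. Poly_Mapping.lookup p \<mu> * monom_eval s \<mu> *
        (if degree_in S \<mu> = d then 1 else 0))) at_top"
    by (intro tendsto_sum tendsto_mult tendsto_const lim assms)
  moreover have "(\<Sum>\<mu>\<in>Poly_Mapping.keys p. Poly_Mapping.lookup p \<mu> * monom_eval s \<mu> *
        (c ^ degree_in S \<mu> / c ^ d)) =
      poly_eval (\<lambda>v. if v \<in> S then c * s v else s v) p / c ^ d" for c
    by (simp add: poly_eval_monom_eval monom_eval_scale sum_divide_distrib mult_ac)
  moreover have "(\<Sum>\<mu>\<in>Poly_Mapping.keys p. Poly_Mapping.lookup p \<mu> * monom_eval s \<mu> *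
        (if degree_in S \<mu> = d then 1 else 0)) =
      (\<Sum>\<mu>\<in>{\<mu> \<in> Poly_Mapping.keys p. degree_in S \<mu> = d}. Poly_Mapping.lookup p \<mu> * monom_eval s \<mu>)"
    by (subst sum.inter_filter) (auto intro!: sum.cong)
  ultimately show ?thesis by simp
qed

text \<open>The top-degree parts of the summands cannot cancel, as their squares sum to the
  degree \<open>2 * d\<close> part of \<open>p\<close>.\<close>

lemma degree_in_sum_of_squares_less:
  fixes g :: "nat \<Rightarrow> 'v rpoly"
  assumes p: "p = (\<Sum>t<r. g t ^ 2)"
    and deg_p: "\<And>\<mu>. \<mu> \<in> Poly_Mapping.keys p \<Longrightarrow> degree_in S \<mu> < 2 * d"
    and deg_g: "\<And>t \<mu>. t < r \<Longrightarrow> \<mu> \<in> Poly_Mapping.keys (g t) \<Longrightarrow> degree_in S \<mu> \<le> d"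
    and t: "t < r" and \<mu>: "\<mu> \<in> Poly_Mapping.keys (g t)"
  shows "degree_in S \<mu> < d"
proof (rule ccontr)
  assume "\<not> degree_in S \<mu> < d"
  then have deg_\<mu>: "degree_in S \<mu> = d" using deg_g[OF t \<mu>] by simp
  define top where "top u = {\<mu> \<in> Poly_Mapping.keys (g u). degree_in S \<mu> = d}" for u
  \<comment> \<open>The top part of \<open>g t\<close> is shown to vanish as a function;
    independence of monomials then kills the coefficient of \<open>\<mu>\<close>, against its lying
    in the support.\<close>
  have "(\<Sum>\<mu>\<in>top t. Poly_Mapping.lookup (g t) \<mu> * monom_eval s \<mu>) = 0" for s
  proof -
    let ?s = "\<lambda>c v. if v \<in> S then c * s v else s v"
    let ?T = "\<lambda>u. \<Sum>\<mu>\<in>top u. Poly_Mapping.lookup (g u) \<mu> * monom_eval s \<mu>"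
    have "((\<lambda>c. \<Sum>u<r. (poly_eval (?s c) (g u) / c ^ d) ^ 2) \<longlongrightarrow> (\<Sum>u<r. ?T u ^ 2)) at_top"
      unfolding top_def using deg_g
      by (intro tendsto_sum tendsto_power poly_eval_scale_tendsto) auto
    moreover have "(\<Sum>u<r. (poly_eval (?s c) (g u) / c ^ d) ^ 2) = poly_eval (?s c) p / c ^ (2 * d)"
      for c
      by (simp add: p power_divide sum_divide_distrib power_even_eq)
    moreover have "((\<lambda>c. poly_eval (?s c) p / c ^ (2 * d)) \<longlongrightarrow> 0) at_top"
    proof -
      have "{\<mu> \<in> Poly_Mapping.keys p. degree_in S \<mu> = 2 * d} = {}"
        using deg_p by force
      then show ?thesis
        using poly_eval_scale_tendsto[of p S "2 * d" s] deg_p[THEN less_imp_le]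
        by (simp only: sum.empty)
    qed
    \<comment> \<open>The same limit is computed through the \<open>g u\<close> and through
      \<open>p\<close>. A vanishing sum of real squares makes every \<open>?T u\<close>
      zero.\<close>
    ultimately have "(\<Sum>u<r. ?T u ^ 2) = 0"
      using tendsto_unique[OF trivial_limit_at_top_linorder] by auto
    then show ?thesis
      using t by (subst (asm) sum_nonneg_eq_0_iff) auto
  qed
  then have "Poly_Mapping.lookup (g t) \<mu> = 0"
    by (rule monom_eval_independent[rotated]) (use \<mu> deg_\<mu> in \<open>auto simp: top_def\<close>)
  then show False using \<mu> by (simp add: in_keys_iff)
qed

section \<open>Splitting monomials into variables\<close>

lemma degree_in_Suc_cases:
  assumes "Poly_Mapping.keys \<mu> \<subseteq> V" "degree_in V \<mu> = Suc d"
  obtains v \<nu> where "v \<in> V" "\<mu> = Poly_Mapping.single v 1 + \<nu>" "Poly_Mapping.keys \<nu> \<subseteq> V"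
    "degree_in V \<nu> = d"
proof -
  have "Poly_Mapping.keys \<mu> \<noteq> {}" using assms(2) by (auto simp: degree_in_def)
  then obtain v where v: "v \<in> Poly_Mapping.keys \<mu>" by blast
  let ?\<nu> = "\<mu> - Poly_Mapping.single v 1"
  \<comment> \<open>Natural-number subtraction is exact here because \<open>v\<close> has positive
    exponent in \<open>\<mu>\<close>.\<close>
  have eq: "\<mu> = Poly_Mapping.single v 1 + ?\<nu>"
    using v by (intro poly_mapping_eqI) (auto simp: lookup_add lookup_minus lookup_single when_def in_keys_iff)
  have "Poly_Mapping.keys ?\<nu> \<subseteq> Poly_Mapping.keys \<mu>"
    by (auto simp: in_keys_iff lookup_minus)
  moreover have "degree_in V \<mu> = degree_in V (Poly_Mapping.single v 1) + degree_in V ?\<nu>"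
    using eq degree_in_plus by metis
  ultimately show thesis
    using that[of v ?\<nu>] eq v assms by (auto simp: subset_iff)
qed

lemma degree_in_2_cases:
  assumes "Poly_Mapping.keys \<mu> \<subseteq> V" "degree_in V \<mu> = 2"
  obtains v w where "v \<in> V" "w \<in> V" "\<mu> = Poly_Mapping.single v 1 + Poly_Mapping.single w 1"
proof -
  obtain v \<nu> where v: "v \<in> V" "\<mu> = Poly_Mapping.single v 1 + \<nu>" "Poly_Mapping.keys \<nu> \<subseteq> V"
      "degree_in V \<nu> = 1"
    using assms by (auto simp: numeral_2_eq_2 elim: degree_in_Suc_cases)
  then obtain w \<kappa> where w: "w \<in> V" "\<nu> = Poly_Mapping.single w 1 + \<kappa>" "Poly_Mapping.keys \<kappa> \<subseteq> V"
      "degree_in V \<kappa> = 0"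
    by (auto elim: degree_in_Suc_cases)
  then have "\<kappa> = 0"
    by (auto simp: degree_in_keys_subset in_keys_iff intro!: poly_mapping_eqI)
  then show thesis using v w that by simp
qed

section \<open>Biquadratic functions and dehomogenization\<close>

definition biquadratic ::
    "nat \<Rightarrow> nat \<Rightarrow> (nat \<Rightarrow> nat \<Rightarrow> nat \<Rightarrow> nat \<Rightarrow> real) \<Rightarrow> (nat \<Rightarrow> real) \<Rightarrow> (nat \<Rightarrow> real) \<Rightarrow> real" where
  "biquadratic m n a x y = (\<Sum>i=1..m. \<Sum>j=1..m. \<Sum>k=1..n. \<Sum>l=1..n. a i j k l * x i * x j * y k * y l)"

lemma poly_eval_biquadratic_form:
  "poly_eval s (biquadratic_form m n a) = biquadratic m n a (s \<circ> X) (s \<circ> Y)"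
  by (simp add: biquadratic_form_def biquadratic_def)

lemma biquadratic_scale:
  "biquadratic m n a (\<lambda>i. b * x i) (\<lambda>k. c * y k) = (b * c) ^ 2 * biquadratic m n a x y"
  by (simp add: biquadratic_def sum_distrib_left power2_eq_square mult_ac)

text \<open>If both last coordinates are nonzero, dividing each block by its last coordinate changes
  the value only by a positive square factor. Other points are limits of such points.\<close>

lemma biquadratic_nonneg_dehomogenize:
  assumes "\<And>x y. x m = 1 \<Longrightarrow> y n = 1 \<Longrightarrow> 0 \<le> biquadratic m n a x y"
  shows "0 \<le> biquadratic m n a x y"
proof -
  let ?F = "\<lambda>e. biquadratic m n a (\<lambda>i. x i + e) (\<lambda>k. y k + e)"
  have "(?F \<longlongrightarrow> biquadratic m n a (\<lambda>i. x i + 0) (\<lambda>k. y k + 0)) (at 0)"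
    unfolding biquadratic_def by (intro tendsto_intros)
  \<comment> \<open>Only \<open>e = - x m\<close> and \<open>e = - y n\<close> make a shifted last
    coordinate vanish, and both are avoided close to, but different from, 0.\<close>
  moreover have "eventually (\<lambda>e. 0 \<le> ?F e) (at 0)"
    using eventually_neq_at_within[of "- x m"] eventually_neq_at_within[of "- y n"]
  proof eventually_elim
    case (elim e)
    then have nz: "x m + e \<noteq> 0" "y n + e \<noteq> 0" by auto
    have "?F e = ((x m + e) * (y n + e)) ^ 2 *
        biquadratic m n a (\<lambda>i. (x i + e) / (x m + e)) (\<lambda>k. (y k + e) / (y n + e))"
      using nz by (subst biquadratic_scale[symmetric]) simp
    also have "\<dots> \<ge> 0"
      using nz by (intro mult_nonneg_nonneg assms) auto
    finally show ?case .
  qed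
  ultimately show ?thesis
    by (auto intro: tendsto_lowerbound)
qed

lemma biquadratic_diff:
  "biquadratic m n (\<lambda>i j k l. a i j k l - b i j k l) x y =
    biquadratic m n a x y - biquadratic m n b x y"
  by (simp add: biquadratic_def left_diff_distrib sum_subtractf)

text \<open>Both differences are biquadratic and vanish on the slice, so nonnegativity applied twice
  gives equality without a second limit argument.\<close>

lemma biquadratic_eq_dehomogenize:
  assumes "\<And>x y. x m = 1 \<Longrightarrow> y n = 1 \<Longrightarrow> biquadratic m n a x y = biquadratic m n b x y"
  shows "biquadratic m n a x y = biquadratic m n b x y"
proof (rule antisym)
  show "biquadratic m n a x y \<le> biquadratic m n b x y"
    using biquadratic_nonneg_dehomogenize[of m n "\<lambda>i j k l. b i j k l - a i j k l" x y] assms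
    by (simp add: biquadratic_diff)
  show "biquadratic m n b x y \<le> biquadratic m n a x y"
    using biquadratic_nonneg_dehomogenize[of m n "\<lambda>i j k l. a i j k l - b i j k l" x y] assms
    by (simp add: biquadratic_diff)
qed

section \<open>Bilinear forms and sums of their squares\<close>

definition bilinear :: "nat \<Rightarrow> nat \<Rightarrow> (nat \<Rightarrow> nat \<Rightarrow> real) \<Rightarrow> (nat \<Rightarrow> real) \<Rightarrow> (nat \<Rightarrow> real) \<Rightarrow> real" where
  "bilinear m n A x y = (\<Sum>i=1..m. \<Sum>k=1..n. A i k * x i * y k)"

text \<open>Exhibits the sum as biquadratic with an explicit coefficient array, so that it can be
  compared with another biquadratic function on the slice.\<close>

lemma sum_bilinear_squares:
  "(\<Sum>t<r. bilinear m n (A t) x y ^ 2) = biquadratic m n (\<lambda>i j k l. \<Sum>t<r. A t i k * A t j l) x y"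
proof -
  have "bilinear m n (A t) x y ^ 2 =
      (\<Sum>i=1..m. \<Sum>j=1..m. \<Sum>k=1..n. \<Sum>l=1..n. A t i k * A t j l * x i * x j * y k * y l)" for t
    by (simp add: bilinear_def power2_eq_square sum_product mult_ac)
  then have "(\<Sum>t<r. bilinear m n (A t) x y ^ 2) =
     (\<Sum>t<r. \<Sum>i=1..m. \<Sum>j=1..m. \<Sum>k=1..n. \<Sum>l=1..n. A t i k * A t j l * x i * x j * y k * y l)"
    by simp
  also have "\<dots> = biquadratic m n (\<lambda>i j k l. \<Sum>t<r. A t i k * A t j l) x y"
    unfolding biquadratic_def sum_distrib_right
    by (simp only: sum.swap[of _ _ "{..<r}"])
  finally show ?thesis .
qed

section \<open>The tripartite form\<close>

definition merge :: "nat \<Rightarrow> nat \<Rightarrow> vars \<Rightarrow> vars" where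
  "merge m n v = (if v = X m \<or> v = Y n then Z else v)"

text \<open>This is the biquadratic form after the substitution \<open>merge m n\<close>, written
  monomial by monomial so that its support can be bounded directly.\<close>

definition merged_form ::
    "nat \<Rightarrow> nat \<Rightarrow> (nat \<Rightarrow> nat \<Rightarrow> nat \<Rightarrow> nat \<Rightarrow> real) \<Rightarrow> vars rpoly" where
  "merged_form m n a =
     (\<Sum>i=1..m. \<Sum>j=1..m. \<Sum>k=1..n. \<Sum>l=1..n. Poly_Mapping.single
        (Poly_Mapping.single (merge m n (X i)) 1 + Poly_Mapping.single (merge m n (X j)) 1 +
         Poly_Mapping.single (merge m n (Y k)) 1 + Poly_Mapping.single (merge m n (Y l)) 1)
        (a i j k l))"

lemma poly_eval_merged_form:
  "poly_eval s (merged_form m n a) = poly_eval (s \<circ> merge m n) (biquadratic_form m n a)"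
  by (simp add: merged_form_def biquadratic_form_def monom_eval_plus mult_ac)

text \<open>Only the index \<open>m\<close> is sent to \<open>Z\<close>. Equality of the sets, not
  just inclusion, is what later lets every \<open>x\<close>-variable and \<open>Z\<close> be read
  back as some \<open>merge m n (X i)\<close>.\<close>

lemma merge_X_image:
  assumes "1 \<le> m"
  shows "(\<lambda>i. merge m n (X i)) ` {1..m} = xvars (m - 1) \<union> {Z}"
proof -
  have "{1..m} = insert m {1..m - 1}" using assms by auto
  moreover have "(\<lambda>i. merge m n (X i)) ` {1..m - 1} = xvars (m - 1)"
    unfolding xvars_def by (intro image_cong) (auto simp: merge_def)
  ultimately show ?thesis by (simp only: image_insert) (simp add: merge_def)
qed

lemma merge_Y_image:
  assumes "1 \<le> n"
  shows "(\<lambda>k. merge m n (Y k)) ` {1..n} = yvars (n - 1) \<union> {Z}"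
proof -
  have "{1..n} = insert n {1..n - 1}" using assms by auto
  moreover have "(\<lambda>k. merge m n (Y k)) ` {1..n - 1} = yvars (n - 1)"
    unfolding yvars_def by (intro image_cong) (auto simp: merge_def)
  ultimately show ?thesis by (simp only: image_insert) (simp add: merge_def)
qed

lemma merge_image:
  assumes "1 \<le> m" "1 \<le> n"
  shows "merge m n ` biquadratic_vars m n = tripartite_vars (m - 1) (n - 1)"
proof -
  have "merge m n ` biquadratic_vars m n =
      (\<lambda>i. merge m n (X i)) ` {1..m} \<union> (\<lambda>k. merge m n (Y k)) ` {1..n}"
    by (auto simp: biquadratic_vars_def xvars_def yvars_def)
  then show ?thesis
    by (auto simp: merge_X_image assms merge_Y_image tripartite_vars_def simp del: One_nat_def)
qed

text \<open>Every monomial is a product of two merged \<open>x\<close>-variables and two merged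
  \<open>y\<close>-variables. Merging sends no \<open>y\<close> into the \<open>x\<close>-block and
  no \<open>x\<close> into the \<open>y\<close>-block, so each block degree is at most 2.\<close>

lemma tripartite_merged_form:
  assumes "1 \<le> m" "1 \<le> n"
  shows "tripartite_quartic_form (m - 1) (n - 1) (merged_form m n a)"
proof -
  have disj: "merge m n (Y k) \<notin> xvars (m - 1)" "merge m n (X k) \<notin> yvars (n - 1)" for k
    by (auto simp: merge_def xvars_def yvars_def)
  let ?\<nu> = "\<lambda>i j k l.
      Poly_Mapping.single (merge m n (X i)) 1 + Poly_Mapping.single (merge m n (X j)) 1 +
      Poly_Mapping.single (merge m n (Y k)) 1 + Poly_Mapping.single (merge m n (Y l)) (1::nat)"
  have "Poly_Mapping.keys \<mu> \<subseteq> tripartite_vars (m - 1) (n - 1) \<and>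
      degree_in (tripartite_vars (m - 1) (n - 1)) \<mu> = 4 \<and>
      degree_in (xvars (m - 1)) \<mu> \<le> 2 \<and> degree_in (yvars (n - 1)) \<mu> \<le> 2"
    if \<mu>_in: "\<mu> \<in> Poly_Mapping.keys (merged_form m n a)" for \<mu>
  proof -
    obtain i j k l where \<mu>: "i \<in> {1..m}" "j \<in> {1..m}" "k \<in> {1..n}" "l \<in> {1..n}"
      "\<mu> = ?\<nu> i j k l"
      using \<mu>_in unfolding merged_form_def
      by (elim in_keys_sumE) (blast dest: in_keys_singleD intro: that)
    have "{X i, X j, Y k, Y l} \<subseteq> biquadratic_vars m n"
      using \<mu> by (simp add: biquadratic_vars_def xvars_def yvars_def)
    then have "merge m n ` {X i, X j, Y k, Y l} \<subseteq> tripartite_vars (m - 1) (n - 1)"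
      unfolding merge_image[OF assms, symmetric] by (rule image_mono)
    then show ?thesis
      using disj by (auto simp: \<mu>(5) keys_plus_nat)
  qed
  then show ?thesis
    by (simp add: tripartite_quartic_form_def form_in_def)
qed

lemma psd_merged_form: "psd (biquadratic_form m n a) \<longleftrightarrow> psd (merged_form m n a)"
proof
  assume "psd (biquadratic_form m n a)"
  then show "psd (merged_form m n a)"
    by (simp add: psd_def poly_eval_merged_form)
next
  assume psd: "psd (merged_form m n a)"
  have "0 \<le> biquadratic m n a x y" if "x m = 1" "y n = 1" for x y
  proof -
    \<comment> \<open>\<open>Z\<close> takes the value 1, the common value of \<open>x m\<close> and
      \<open>y n\<close>; hence \<open>s\<close> composed with \<open>merge m n\<close> returns
      exactly \<open>x\<close> and \<open>y\<close>.\<close>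
    define s where "s v = (case v of X i \<Rightarrow> x i | Y k \<Rightarrow> y k | Z \<Rightarrow> 1)" for v
    have "(s \<circ> merge m n) \<circ> X = x" "(s \<circ> merge m n) \<circ> Y = y"
      using that by (auto simp: s_def merge_def)
    moreover have "0 \<le> poly_eval s (merged_form m n a)"
      using psd by (simp add: psd_def)
    ultimately show ?thesis
      by (simp add: poly_eval_merged_form poly_eval_biquadratic_form)
  qed
  then show "psd (biquadratic_form m n a)"
    unfolding psd_def poly_eval_biquadratic_form
    by (auto intro: biquadratic_nonneg_dehomogenize)
qed

text \<open>The possible monomials are \<open>x y\<close>, \<open>x z\<close>, \<open>y z\<close>
  and \<open>z\<close> squared. Reading \<open>z\<close> as the last \<open>x\<close>, the last
  \<open>y\<close>, or one of each turns every one of them into a product of one \<open>x\<close>-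
  and one \<open>y\<close>-variable.\<close>

lemma bilinear_of_quadratic_form:
  assumes "1 \<le> m" "1 \<le> n" and g: "form_in (tripartite_vars (m - 1) (n - 1)) 2 g"
    and deg: "\<And>\<mu>. \<mu> \<in> Poly_Mapping.keys g \<Longrightarrow>
      degree_in (xvars (m - 1)) \<mu> \<le> 1 \<and> degree_in (yvars (n - 1)) \<mu> \<le> 1"
  shows "\<exists>A. \<forall>s. poly_eval s g = bilinear m n A (s \<circ> merge m n \<circ> X) (s \<circ> merge m n \<circ> Y)"
proof -
  let ?x = "\<lambda>s. s \<circ> merge m n \<circ> X" and ?y = "\<lambda>s. s \<circ> merge m n \<circ> Y"
  have "\<exists>i k. i \<in> {1..m} \<and> k \<in> {1..n} \<and> (\<forall>s. monom_eval s \<mu> = ?x s i * ?y s k)"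
    if "\<mu> \<in> Poly_Mapping.keys g" for \<mu>
  proof -
    have "Poly_Mapping.keys \<mu> \<subseteq> tripartite_vars (m - 1) (n - 1)"
        "degree_in (tripartite_vars (m - 1) (n - 1)) \<mu> = 2"
      using g that by (auto simp: form_in_def)
    then obtain v w where vw: "v \<in> tripartite_vars (m - 1) (n - 1)" "w \<in> tripartite_vars (m - 1) (n - 1)"
        and \<mu>: "\<mu> = Poly_Mapping.single v 1 + Poly_Mapping.single w 1"
      by (rule degree_in_2_cases)
    have "\<not> (v \<in> xvars (m - 1) \<and> w \<in> xvars (m - 1))" "\<not> (v \<in> yvars (n - 1) \<and> w \<in> yvars (n - 1))"
      using deg[OF that] by (auto simp: \<mu>)
    \<comment> \<open>With at most one factor from each block, one factor can play the
      \<open>x\<close>-role and the other the \<open>y\<close>-role, \<open>Z\<close> being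
      admissible for both.\<close>
    then have "(v \<in> xvars (m - 1) \<union> {Z} \<and> w \<in> yvars (n - 1) \<union> {Z}) \<or>
        (w \<in> xvars (m - 1) \<union> {Z} \<and> v \<in> yvars (n - 1) \<union> {Z})"
      using vw by (auto simp: tripartite_vars_def)
    moreover have "\<exists>i\<in>{1..m}. u = merge m n (X i)" if "u \<in> xvars (m - 1) \<union> {Z}" for u
      using that merge_X_image[OF assms(1), of n] by blast
    moreover have "\<exists>k\<in>{1..n}. u = merge m n (Y k)" if "u \<in> yvars (n - 1) \<union> {Z}" for u
      using that merge_Y_image[OF assms(2), of m] by blast
    ultimately obtain i k where ik: "i \<in> {1..m}" "k \<in> {1..n}"
        "v = merge m n (X i) \<and> w = merge m n (Y k) \<or> w = merge m n (X i) \<and> v = merge m n (Y k)"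
      by meson
    then have "monom_eval s \<mu> = ?x s i * ?y s k" for s
      by (auto simp: \<mu> monom_eval_plus)
    then show ?thesis using ik(1,2) by blast
  qed
  then obtain I K where IK: "\<And>\<mu>. \<mu> \<in> Poly_Mapping.keys g \<Longrightarrow> I \<mu> \<in> {1..m} \<and> K \<mu> \<in> {1..n} \<and>
      (\<forall>s. monom_eval s \<mu> = ?x s (I \<mu>) * ?y s (K \<mu>))"
    by metis
  \<comment> \<open>Summing over all monomials assigned to a pair of indices avoids any need for
    that assignment to be injective.\<close>
  define A where "A i k = (\<Sum>\<mu>\<in>Poly_Mapping.keys g.
      if i = I \<mu> then if k = K \<mu> then Poly_Mapping.lookup g \<mu> else 0 else 0)" for i k
  have "poly_eval s g = bilinear m n A (?x s) (?y s)" for s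
  proof -
    have "bilinear m n A (?x s) (?y s) = (\<Sum>\<mu>\<in>Poly_Mapping.keys g. \<Sum>i=1..m. \<Sum>k=1..n.
        (if i = I \<mu> then if k = K \<mu> then Poly_Mapping.lookup g \<mu> else 0 else 0) * ?x s i * ?y s k)"
      unfolding bilinear_def A_def sum_distrib_right
      by (simp only: sum.swap[of _ _ "Poly_Mapping.keys g"])
    also have "\<dots> = (\<Sum>\<mu>\<in>Poly_Mapping.keys g. Poly_Mapping.lookup g \<mu> * monom_eval s \<mu>)"
    proof (rule sum.cong)
      fix \<mu> assume \<mu>: "\<mu> \<in> Poly_Mapping.keys g"
      have "(\<Sum>i=1..m. \<Sum>k=1..n.
          (if i = I \<mu> then if k = K \<mu> then Poly_Mapping.lookup g \<mu> else 0 else 0) * ?x s i * ?y s k) =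
        (\<Sum>i=1..m. if i = I \<mu> then Poly_Mapping.lookup g \<mu> * ?x s i * ?y s (K \<mu>) else 0)"
      proof (rule sum.cong)
        fix i assume "i \<in> {1..m}"
        show "(\<Sum>k=1..n.
            (if i = I \<mu> then if k = K \<mu> then Poly_Mapping.lookup g \<mu> else 0 else 0) * ?x s i * ?y s k) =
          (if i = I \<mu> then Poly_Mapping.lookup g \<mu> * ?x s i * ?y s (K \<mu>) else 0)"
          using IK[OF \<mu>] by (cases "i = I \<mu>") (simp_all add: if_distrib[of "\<lambda>c. c * _"] cong: if_cong)
      qed simp
      also have "\<dots> = Poly_Mapping.lookup g \<mu> * monom_eval s \<mu>"
        using IK[OF \<mu>] by (simp add: mult_ac)
      finally show "(\<Sum>i=1..m. \<Sum>k=1..n.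
          (if i = I \<mu> then if k = K \<mu> then Poly_Mapping.lookup g \<mu> else 0 else 0) * ?x s i * ?y s k) =
        Poly_Mapping.lookup g \<mu> * monom_eval s \<mu>" .
    qed simp
    finally show ?thesis by (simp add: poly_eval_monom_eval)
  qed
  then show ?thesis by blast
qed

lemma bilinear_form_in:
  "form_in (biquadratic_vars m n) 2 (\<Sum>i=1..m. \<Sum>k=1..n. cst (A i k) * var (X i) * var (Y k))"
  by (intro form_in_sum)
    (auto simp: cst_def var_def mult_single keys_plus_nat biquadratic_vars_def xvars_def yvars_def
      intro!: form_in_single)

text \<open>Stated for each fixed number \<open>r\<close> of squares, so that it yields both the
  equivalence of being sos and the equality of ranks.\<close>

lemma sum_of_squares_merged_form:
  assumes "1 \<le> m" "1 \<le> n"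
  shows "sum_of_squares (biquadratic_vars m n) r (biquadratic_form m n a) \<longleftrightarrow>
    sum_of_squares (tripartite_vars (m - 1) (n - 1)) r (merged_form m n a)"
proof
  assume "sum_of_squares (biquadratic_vars m n) r (biquadratic_form m n a)"
  then show "sum_of_squares (tripartite_vars (m - 1) (n - 1)) r (merged_form m n a)"
    by (rule sum_of_squares_rename_vars) (simp_all only: merge_image[OF assms] poly_eval_merged_form order_refl)
next
  let ?h = "merged_form m n a" and ?V = "tripartite_vars (m - 1) (n - 1)"
  assume "sum_of_squares ?V r ?h"
  then obtain g where g: "\<And>t. t < r \<Longrightarrow> form_in ?V 2 (g t)" and h: "?h = (\<Sum>t<r. g t ^ 2)"
    by (auto simp: sum_of_squares_def)
  \<comment> \<open>To be used with \<open>S\<close> the \<open>x\<close>-block and the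
    \<open>y\<close>-block. Each \<open>g t\<close> has degree at most 2 in \<open>S\<close> because
    its total degree is 2; a degree 2 part would force degree 4 in \<open>S\<close> on the sum,
    which has at most 2.\<close>
  have deg: "degree_in S \<mu> \<le> 1"
    if S: "S \<subseteq> ?V" "\<And>\<mu>. \<mu> \<in> Poly_Mapping.keys ?h \<Longrightarrow> degree_in S \<mu> \<le> 2"
      and t: "t < r" "\<mu> \<in> Poly_Mapping.keys (g t)" for S t \<mu>
  proof -
    have "degree_in S \<mu> < 2"
    proof (rule degree_in_sum_of_squares_less[OF h _ _ t])
      show "degree_in S \<nu> < 2 * 2" if "\<nu> \<in> Poly_Mapping.keys ?h" for \<nu>
        using S(2)[OF that] by simp
      show "degree_in S \<nu> \<le> 2" if "u < r" "\<nu> \<in> Poly_Mapping.keys (g u)" for u \<nu>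
        using g[OF that(1)] that(2) degree_in_mono[OF S(1), of \<nu>] by (simp add: form_in_def)
    qed
    then show ?thesis by simp
  qed
  have "\<exists>A. \<forall>s. poly_eval s (g t) = bilinear m n A (s \<circ> merge m n \<circ> X) (s \<circ> merge m n \<circ> Y)"
    if "t < r" for t
    using that tripartite_merged_form[OF assms, of a] assms
    by (intro bilinear_of_quadratic_form g conjI deg)
      (auto simp: tripartite_quartic_form_def tripartite_vars_def)
  then obtain A where A: "\<And>t s. t < r \<Longrightarrow>
      poly_eval s (g t) = bilinear m n (A t) (s \<circ> merge m n \<circ> X) (s \<circ> merge m n \<circ> Y)"
    by metis
  \<comment> \<open>The lift of \<open>g t\<close>: the same coefficients \<open>A t\<close>, with
    \<open>X m\<close> and \<open>Y n\<close> kept apart instead of both being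
    \<open>Z\<close>.\<close>
  define G where "G t = (\<Sum>i=1..m. \<Sum>k=1..n. cst (A t i k) * var (X i) * var (Y k))" for t
  let ?b = "\<lambda>i j k l. \<Sum>t<r. A t i k * A t j l"
  have "biquadratic m n a x y = biquadratic m n ?b x y" if "x m = 1" "y n = 1" for x y
  proof -
    define s where "s v = (case v of X i \<Rightarrow> x i | Y k \<Rightarrow> y k | Z \<Rightarrow> 1)" for v
    have s: "s \<circ> merge m n \<circ> X = x" "s \<circ> merge m n \<circ> Y = y"
      using that by (auto simp: s_def merge_def)
    have "biquadratic m n a x y = poly_eval s ?h"
      by (simp add: poly_eval_merged_form poly_eval_biquadratic_form s)
    also have "\<dots> = (\<Sum>t<r. bilinear m n (A t) x y ^ 2)"
      by (simp add: h A s)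
    finally show ?thesis by (simp add: sum_bilinear_squares)
  qed
  then have ab: "biquadratic m n a x y = biquadratic m n ?b x y" for x y
    by (rule biquadratic_eq_dehomogenize)
  have "biquadratic_form m n a = (\<Sum>t<r. G t ^ 2)"
  proof (rule poly_eval_inject)
    fix s
    have "poly_eval s (G t) = bilinear m n (A t) (s \<circ> X) (s \<circ> Y)" for t
      by (simp add: G_def bilinear_def)
    then show "poly_eval s (biquadratic_form m n a) = poly_eval s (\<Sum>t<r. G t ^ 2)"
      by (simp add: poly_eval_biquadratic_form ab sum_bilinear_squares)
  qed
  then show "sum_of_squares (biquadratic_vars m n) r (biquadratic_form m n a)"
    unfolding sum_of_squares_def by (intro exI[of _ G]) (simp add: G_def bilinear_form_in flip: One_nat_def)
qed

theorem theorem2p1: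
  fixes m n :: nat
    and a :: "nat \<Rightarrow> nat \<Rightarrow> nat \<Rightarrow> nat \<Rightarrow> real"
    and f :: "vars rpoly"
  assumes "m \<ge> 2" and "n \<ge> 2"
    and "f = biquadratic_form m n a"
  shows "\<exists>h. tripartite_quartic_form (m - 1) (n - 1) h
           \<and> (psd f \<longleftrightarrow> psd h)
           \<and> (sos (biquadratic_vars m n) f \<longleftrightarrow> sos (tripartite_vars (m - 1) (n - 1)) h)
           \<and> (sos (biquadratic_vars m n) f \<and> sos (tripartite_vars (m - 1) (n - 1)) h \<longrightarrow>
                sos_rank (biquadratic_vars m n) f = sos_rank (tripartite_vars (m - 1) (n - 1)) h)"
proof (intro exI conjI impI)
  let ?h = "merged_form m n a"
  \<comment> \<open>The two predicates in \<open>r\<close> coincide, hence so do their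
    satisfiability and their least witnesses.\<close>
  have sq: "sum_of_squares (biquadratic_vars m n) r f \<longleftrightarrow>
      sum_of_squares (tripartite_vars (m - 1) (n - 1)) r ?h" for r
    using sum_of_squares_merged_form assms by simp
  show "tripartite_quartic_form (m - 1) (n - 1) ?h"
    using assms(1,2) by (intro tripartite_merged_form) simp_all
  show "psd f \<longleftrightarrow> psd ?h"
    by (simp add: assms(3) psd_merged_form)
  show "sos (biquadratic_vars m n) f \<longleftrightarrow> sos (tripartite_vars (m - 1) (n - 1)) ?h"
    by (simp add: sos_def sq)
  show "sos_rank (biquadratic_vars m n) f = sos_rank (tripartite_vars (m - 1) (n - 1)) ?h"
    by (simp add: sos_rank_def sq)
qed

end
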